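(* Let $X_\bullet:\Phi_*\to\mathbf{Set}$ be a $\Gamma$-set, and let $\hat X_\bullet:\Phi\to\mathbf{Set}$ be the cosymmetric set obtained by composing $X_\bullet$ with the basepoint-adjoining functor $\Phi\to\Phi_*$ (so $\hat X_n=X_{n+1}$). If $X_\bullet$ is $2$-Segal, then $\hat X_\bullet$ is $2$-Segal.
   Context: Write $[n]=\{0,1,\dots,n\}$, $n\ge0$. $\Phi$ is the full subcategory of $\mathbf{Set}$ on the objects $[n]$; $\Phi_*\subset\Phi$ is the subcategory with the same objects and with morphisms the maps $f:[m]\to[n]$ satisfying $f(0)=0$. A $\Gamma$-set is a functor $\Phi_*\to\mathbf{Set}$; a cosymmetric set is a functor $\Phi\to\mathbf{Set}$ (which restricts to a $\Gamma$-set). The underlying simplicial set of a $\Gamma$-set or cosymmetric set is obtained by composing with the functor $\mathsf{Cut}:\Delta^{\mathrm{op}}\to\Phi_*$, identity on objects, given by: for $0\le i<n$, $d_i^n:[n]\to[n-1]$ sends $k\mapsto k$ for $k\le i$, $k\mapsto k-1$ for $k>i$; $d_n^n$ sends $k\mapsto k$ for $k<n$ and $n\mapsto0$; $s_i^n:[n]\to[n+1]$, $0\le i\le n$, sends $k\mapsto k$ for $k\le i$, $k\mapsto k+1$ for $k>i$. A simplicial set $X_\bullet$ is *$2$-Segal* if for all $0<i<n$ the maps $(d_{i+1},d_0):X_{n+1}\to X_n\times_{d_0,X_{n-1},d_i}X_n$ and $(d_i,d_{n+1}):X_{n+1}\to X_n\times_{d_n,X_{n-1},d_i}X_n$ are bijections.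 A $\Gamma$-set or cosymmetric set is $2$-Segal if its underlying simplicial set is. The basepoint-adjoining functor $\Phi\to\Phi_*$ sends $[n]$ to $[n+1]$ and $f:[m]\to[n]$ to $\hat f:[m+1]\to[n+1]$ with $\hat f(0)=0$ and $\hat f(i)=f(i-1)+1$ for $1\le i\le m+1$. *)

theory Defs
  imports Main "HOL-Library.FuncSet"
begin

text \<open>
  The object $[n]$ is represented by the number \<open>n\<close> and a map $[m] \to [n]$ by an extensional
  function, so that equality of morphisms is equality in HOL. Composition is \<open>compose {0..l}\<close> and
  the identity is \<open>\<lambda>k\<in>{0..n}. k\<close>.
\<close>

definition Phi_hom :: "nat \<Rightarrow> nat \<Rightarrow> (nat \<Rightarrow> nat) set" where
  "Phi_hom m n = {0..m} \<rightarrow>\<^sub>E {0..n}"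

definition PhiS_hom :: "nat \<Rightarrow> nat \<Rightarrow> (nat \<Rightarrow> nat) set" where
  "PhiS_hom m n = {f \<in> Phi_hom m n. f 0 = 0}"

text \<open>
  \<open>Mor X m n f\<close> is only meaningful for \<open>f\<close> in the hom-set from $[m]$ to $[n]$ under consideration;
  other values are junk and unconstrained. The values \<open>Ob X n\<close> live in one type \<open>'a\<close>; this is no
  restriction, since the index categories are small.
\<close>

record 'a fin_functor =
  Ob :: "nat \<Rightarrow> 'a set"
  Mor :: "nat \<Rightarrow> nat \<Rightarrow> (nat \<Rightarrow> nat) \<Rightarrow> 'a \<Rightarrow> 'a"

definition set_functor :: "(nat \<Rightarrow> nat \<Rightarrow> (nat \<Rightarrow> nat) set) \<Rightarrow> 'a fin_functor \<Rightarrow> bool" where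
  "set_functor hom X \<longleftrightarrow>
     (\<forall>m n. \<forall>f \<in> hom m n. Mor X m n f \<in> Ob X m \<rightarrow>\<^sub>E Ob X n) \<and>
     (\<forall>n. Mor X n n (\<lambda>k\<in>{0..n}. k) = (\<lambda>x\<in>Ob X n. x)) \<and>
     (\<forall>l m n. \<forall>f \<in> hom l m. \<forall>g \<in> hom m n.
        Mor X l n (compose {0..l} g f) = compose (Ob X l) (Mor X m n g) (Mor X l m f))"

definition Gamma_set :: "'a fin_functor \<Rightarrow> bool" where
  "Gamma_set X \<longleftrightarrow> set_functor PhiS_hom X"

definition cosymmetric_set :: "'a fin_functor \<Rightarrow> bool" where
  "cosymmetric_set X \<longleftrightarrow> set_functor Phi_hom X"

text \<open>Restriction of a cosymmetric set to pointed maps does not change the underlying record.\<close>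

lemma cosymmetric_set_imp_Gamma_set: "cosymmetric_set X \<Longrightarrow> Gamma_set X"
  unfolding cosymmetric_set_def Gamma_set_def set_functor_def PhiS_hom_def by blast

text \<open>
  \<open>face S n i\<close> is $d_i : S_n \to S_{n-1}$, meaningful for \<open>n \<ge> 1\<close> and \<open>i \<le> n\<close>;
  \<open>degen S n i\<close> is $s_i : S_n \to S_{n+1}$, meaningful for \<open>i \<le> n\<close>.
\<close>

record 'a sset =
  simplices :: "nat \<Rightarrow> 'a set"
  face :: "nat \<Rightarrow> nat \<Rightarrow> 'a \<Rightarrow> 'a"
  degen :: "nat \<Rightarrow> nat \<Rightarrow> 'a \<Rightarrow> 'a"

definition simplicial_set :: "'a sset \<Rightarrow> bool" where
  "simplicial_set S \<longleftrightarrow>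
     (\<forall>n i. 1 \<le> n \<longrightarrow> i \<le> n \<longrightarrow> face S n i \<in> simplices S n \<rightarrow>\<^sub>E simplices S (n - 1)) \<and>
     (\<forall>n i. i \<le> n \<longrightarrow> degen S n i \<in> simplices S n \<rightarrow>\<^sub>E simplices S (n + 1)) \<and>
     (\<forall>n i j. \<forall>x \<in> simplices S n. 2 \<le> n \<longrightarrow> i < j \<longrightarrow> j \<le> n \<longrightarrow>
        face S (n - 1) i (face S n j x) = face S (n - 1) (j - 1) (face S n i x)) \<and>
     (\<forall>n i j. \<forall>x \<in> simplices S n. i < j \<longrightarrow> j \<le> n \<longrightarrow>
        face S (n + 1) i (degen S n j x) = degen S (n - 1) (j - 1) (face S n i x)) \<and>
     (\<forall>n j. \<forall>x \<in> simplices S n. j \<le> n \<longrightarrow>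
        face S (n + 1) j (degen S n j x) = x \<and> face S (n + 1) (j + 1) (degen S n j x) = x) \<and>
     (\<forall>n i j. \<forall>x \<in> simplices S n. j + 1 < i \<longrightarrow> i \<le> n + 1 \<longrightarrow>
        face S (n + 1) i (degen S n j x) = degen S (n - 1) j (face S n (i - 1) x)) \<and>
     (\<forall>n i j. \<forall>x \<in> simplices S n. i \<le> j \<longrightarrow> j \<le> n \<longrightarrow>
        degen S (n + 1) i (degen S n j x) = degen S (n + 1) (j + 1) (degen S n i x))"

definition fibre_product :: "'a set \<Rightarrow> 'b set \<Rightarrow> ('a \<Rightarrow> 'c) \<Rightarrow> ('b \<Rightarrow> 'c) \<Rightarrow> ('a \<times> 'b) set" where
  "fibre_product A B f g = {(x, y). x \<in> A \<and> y \<in> B \<and> f x = g y}"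

definition two_Segal_sset :: "'a sset \<Rightarrow> bool" where
  "two_Segal_sset S \<longleftrightarrow>
     (\<forall>n i. 0 < i \<longrightarrow> i < n \<longrightarrow>
        bij_betw (\<lambda>x. (face S (n + 1) (i + 1) x, face S (n + 1) 0 x))
          (simplices S (n + 1))
          (fibre_product (simplices S n) (simplices S n) (face S n 0) (face S n i)) \<and>
        bij_betw (\<lambda>x. (face S (n + 1) i x, face S (n + 1) (n + 1) x))
          (simplices S (n + 1))
          (fibre_product (simplices S n) (simplices S n) (face S n n) (face S n i)))"

text \<open>
  \<open>Cut_d n i\<close> and \<open>Cut_s n i\<close> are the images under Cut of the generators $d_i^n$ (\<open>n \<ge> 1\<close>, \<open>i \<le> n\<close>)
  and $s_i^n$ (\<open>i \<le> n\<close>); the \<open>else\<close> branch of \<open>Cut_d\<close> is the last face, which sends \<open>n\<close> to the basepoint.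
\<close>

definition Cut_d :: "nat \<Rightarrow> nat \<Rightarrow> nat \<Rightarrow> nat" where
  "Cut_d n i = (\<lambda>k\<in>{0..n}.
     if i < n then (if k \<le> i then k else k - 1) else (if k < n then k else 0))"

definition Cut_s :: "nat \<Rightarrow> nat \<Rightarrow> nat \<Rightarrow> nat" where
  "Cut_s n i = (\<lambda>k\<in>{0..n}. if k \<le> i then k else k + 1)"

definition underlying_sset :: "'a fin_functor \<Rightarrow> 'a sset" where
  "underlying_sset X =
     \<lparr>simplices = Ob X,
      face = (\<lambda>n i. Mor X n (n - 1) (Cut_d n i)),
      degen = (\<lambda>n i. Mor X n (n + 1) (Cut_s n i))\<rparr>"

definition two_Segal :: "'a fin_functor \<Rightarrow> bool" where
  "two_Segal X \<longleftrightarrow> two_Segal_sset (underlying_sset X)"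

definition adjoin_base :: "nat \<Rightarrow> (nat \<Rightarrow> nat) \<Rightarrow> nat \<Rightarrow> nat" where
  "adjoin_base m f = (\<lambda>i\<in>{0..m + 1}. if i = 0 then 0 else f (i - 1) + 1)"

definition hat :: "'a fin_functor \<Rightarrow> 'a fin_functor" where
  "hat X =
     \<lparr>Ob = (\<lambda>n. Ob X (n + 1)),
      Mor = (\<lambda>m n f. Mor X (m + 1) (n + 1) (adjoin_base m f))\<rparr>"

lemma Cut_d_hom: "1 \<le> n \<Longrightarrow> i \<le> n \<Longrightarrow> Cut_d n i \<in> PhiS_hom n (n - 1)"
  by (auto simp: PhiS_hom_def Phi_hom_def Cut_d_def)

lemma Cut_s_hom: "i \<le> n \<Longrightarrow> Cut_s n i \<in> PhiS_hom n (n + 1)"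
  by (auto simp: PhiS_hom_def Phi_hom_def Cut_s_def)

lemma adjoin_base_hom: "f \<in> Phi_hom m n \<Longrightarrow> adjoin_base m f \<in> PhiS_hom (m + 1) (n + 1)"
  by (auto simp: PhiS_hom_def Phi_hom_def adjoin_base_def PiE_iff)

lemma adjoin_base_id: "adjoin_base n (\<lambda>k\<in>{0..n}. k) = (\<lambda>k\<in>{0..n + 1}. k)"
  by (auto simp: adjoin_base_def fun_eq_iff)

lemma adjoin_base_compose:
  assumes "f \<in> Phi_hom l m"
  shows "adjoin_base l (compose {0..l} g f) =
    compose {0..l + 1} (adjoin_base m g) (adjoin_base l f)"
  using assms by (auto simp: adjoin_base_def compose_def Phi_hom_def PiE_iff fun_eq_iff)

lemma cosymmetric_set_hat:
  assumes "Gamma_set X"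
  shows "cosymmetric_set (hat X)"
proof -
  have X: "set_functor PhiS_hom X"
    using assms by (simp add: Gamma_set_def)
  show ?thesis
    unfolding cosymmetric_set_def set_functor_def
  proof (intro conjI allI ballI)
    fix m n f assume "f \<in> Phi_hom m n"
    then show "Mor (hat X) m n f \<in> Ob (hat X) m \<rightarrow>\<^sub>E Ob (hat X) n"
      using X adjoin_base_hom by (simp add: hat_def set_functor_def)
  next
    fix n
    show "Mor (hat X) n n (\<lambda>k\<in>{0..n}. k) = (\<lambda>x\<in>Ob (hat X) n. x)"
      using X adjoin_base_id by (simp add: hat_def set_functor_def)
  next
    fix l m n f g assume f: "f \<in> Phi_hom l m" and g: "g \<in> Phi_hom m n"
    have "Mor X (l + 1) (n + 1) (compose {0..l + 1} (adjoin_base m g) (adjoin_base l f)) =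
      compose (Ob X (l + 1)) (Mor X (m + 1) (n + 1) (adjoin_base m g))
        (Mor X (l + 1) (m + 1) (adjoin_base l f))"
      using X adjoin_base_hom[OF f] adjoin_base_hom[OF g] unfolding set_functor_def by blast
    then show "Mor (hat X) l n (compose {0..l} g f) =
        compose (Ob (hat X) l) (Mor (hat X) m n g) (Mor (hat X) l m f)"
      by (simp add: hat_def adjoin_base_compose[OF f])
  qed
qed

lemma simplicial_set_underlying:
  assumes "Gamma_set X"
  shows "simplicial_set (underlying_sset X)"
proof -
  have X: "set_functor PhiS_hom X"
    using assms by (simp add: Gamma_set_def)
  have maps: "Mor X m n f \<in> Ob X m \<rightarrow>\<^sub>E Ob X n" if "f \<in> PhiS_hom m n" for m n f
    using X that unfolding set_functor_def by blast
  have ident: "Mor X n n (\<lambda>k\<in>{0..n}. k) x = x" if "x \<in> Ob X n" for n x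
    using X that by (simp add: set_functor_def)
  have comp: "Mor X m n g (Mor X l m f x) = Mor X l n (compose {0..l} g f) x"
    if "f \<in> PhiS_hom l m" "g \<in> PhiS_hom m n" "x \<in> Ob X l" for l m n f g x
  proof -
    have "Mor X l n (compose {0..l} g f) = compose (Ob X l) (Mor X m n g) (Mor X l m f)"
      using X that unfolding set_functor_def by blast
    then show ?thesis using that by (simp add: compose_def)
  qed
  have dd: "compose {0..n} (Cut_d (n - 1) i) (Cut_d n j) =
      compose {0..n} (Cut_d (n - 1) (j - 1)) (Cut_d n i)"
    if "2 \<le> n" "i < j" "j \<le> n" for n i j
    using that by (auto simp: compose_def Cut_d_def fun_eq_iff)
  have ds1: "compose {0..n} (Cut_d (n + 1) i) (Cut_s n j) =
      compose {0..n} (Cut_s (n - 1) (j - 1)) (Cut_d n i)"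
    if "i < j" "j \<le> n" for n i j
    using that by (auto simp: compose_def Cut_d_def Cut_s_def fun_eq_iff)
  have ds2: "compose {0..n} (Cut_d (n + 1) j) (Cut_s n j) = (\<lambda>k\<in>{0..n}. k)"
    "compose {0..n} (Cut_d (n + 1) (j + 1)) (Cut_s n j) = (\<lambda>k\<in>{0..n}. k)"
    if "j \<le> n" for n j
    using that by (auto simp: compose_def Cut_d_def Cut_s_def fun_eq_iff)
  have ds3: "compose {0..n} (Cut_d (n + 1) i) (Cut_s n j) =
      compose {0..n} (Cut_s (n - 1) j) (Cut_d n (i - 1))"
    if "j + 1 < i" "i \<le> n + 1" for n i j
    using that by (auto simp: compose_def Cut_d_def Cut_s_def fun_eq_iff)
  have ss: "compose {0..n} (Cut_s (n + 1) i) (Cut_s n j) =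
      compose {0..n} (Cut_s (n + 1) (j + 1)) (Cut_s n i)"
    if "i \<le> j" "j \<le> n" for n i j
    using that by (auto simp: compose_def Cut_s_def fun_eq_iff)
  have d: "Cut_d (n + 1) i \<in> PhiS_hom (n + 1) n" if "i \<le> n + 1" for n i
    using Cut_d_hom[of "n + 1" i] that by simp
  have s: "Cut_s (n - 1) i \<in> PhiS_hom (n - 1) n" if "1 \<le> n" "i \<le> n - 1" for n i
    using Cut_s_hom[of i "n - 1"] that by simp
  note defs = underlying_sset_def
  show ?thesis
    unfolding simplicial_set_def
  proof (intro conjI allI ballI impI)
    fix n i :: nat assume "1 \<le> n" "i \<le> n"
    then show "face (underlying_sset X) n i \<in>
        simplices (underlying_sset X) n \<rightarrow>\<^sub>E simplices (underlying_sset X) (n - 1)"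
      using maps[OF Cut_d_hom] by (simp add: defs)
  next
    fix n i :: nat assume "i \<le> n"
    then show "degen (underlying_sset X) n i \<in>
        simplices (underlying_sset X) n \<rightarrow>\<^sub>E simplices (underlying_sset X) (n + 1)"
      using maps[OF Cut_s_hom] by (simp add: defs)
  next
    fix n i j x assume x: "x \<in> simplices (underlying_sset X) n" and "2 \<le> n" "i < j" "j \<le> n"
    then show "face (underlying_sset X) (n - 1) i (face (underlying_sset X) n j x) =
        face (underlying_sset X) (n - 1) (j - 1) (face (underlying_sset X) n i x)"
      using dd[of n i j] comp[OF Cut_d_hom Cut_d_hom, of n j i x]
        comp[OF Cut_d_hom Cut_d_hom, of n i "j - 1" x]
      by (simp add: defs)
  next
    fix n i j x assume x: "x \<in> simplices (underlying_sset X) n" and "i < j" "j \<le> n"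
    then show "face (underlying_sset X) (n + 1) i (degen (underlying_sset X) n j x) =
        degen (underlying_sset X) (n - 1) (j - 1) (face (underlying_sset X) n i x)"
      using ds1[of i j n] comp[OF Cut_s_hom d, of j n i x] comp[OF Cut_d_hom s, of n i "j - 1" x]
      by (simp add: defs)
  next
    fix n j x assume x: "x \<in> simplices (underlying_sset X) n" and "j \<le> n"
    then show "face (underlying_sset X) (n + 1) j (degen (underlying_sset X) n j x) = x"
      using ds2(1)[of j n] comp[OF Cut_s_hom d, of j n j x] ident by (simp add: defs)
  next
    fix n j x assume x: "x \<in> simplices (underlying_sset X) n" and "j \<le> n"
    then show "face (underlying_sset X) (n + 1) (j + 1) (degen (underlying_sset X) n j x) = x"
      using ds2(2)[of j n] comp[OF Cut_s_hom d, of j n "j + 1" x] ident by (simp add: defs)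
  next
    fix n i j x assume x: "x \<in> simplices (underlying_sset X) n" and "j + 1 < i" "i \<le> n + 1"
    then show "face (underlying_sset X) (n + 1) i (degen (underlying_sset X) n j x) =
        degen (underlying_sset X) (n - 1) j (face (underlying_sset X) n (i - 1) x)"
      using ds3[of j i n] comp[OF Cut_s_hom d, of j n i x]
        comp[OF Cut_d_hom s, of n "i - 1" j x]
      by (simp add: defs)
  next
    fix n i j x assume x: "x \<in> simplices (underlying_sset X) n" and "i \<le> j" "j \<le> n"
    then show "degen (underlying_sset X) (n + 1) i (degen (underlying_sset X) n j x) =
        degen (underlying_sset X) (n + 1) (j + 1) (degen (underlying_sset X) n i x)"
      using ss[of i j n] comp[OF Cut_s_hom Cut_s_hom, of j n i x]
        comp[OF Cut_s_hom Cut_s_hom, of i n "j + 1" x]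
      by (simp add: defs)
  qed
qed

end

(*
  In X, the simplicial 2-Segal conditions say that merging the basepoint with a neighbour b and
  merging two further neighbours c, d is a pullback square. For hat X one has to merge two
  non-basepoint elements a, b instead of the basepoint with b. Merging {0, a} and then b agrees with
  merging {a, b} first and then adjoining the result to 0. Along the first route two pullback squares
  (each against {c, d}) are pasted, so the outer square is a pullback; along the second route the
  last square is a pullback, so by cancellation the square for {a, b} and {c, d} is one, too.
*)
theory Submission
  imports Defs
begin

lemma bij_betw_fibre_productI:
  assumes "\<And>x. x \<in> A \<Longrightarrow> f x \<in> B" "\<And>x. x \<in> A \<Longrightarrow> g x \<in> C"
    and "\<And>x. x \<in> A \<Longrightarrow> h (f x) = k (g x)"
    and "\<And>x x'. x \<in> A \<Longrightarrow> x' \<in> A \<Longrightarrow> f x = f x' \<Longrightarrow> g x = g x' \<Longrightarrow> x = x'"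
    and "\<And>y z. y \<in> B \<Longrightarrow> z \<in> C \<Longrightarrow> h y = k z \<Longrightarrow> \<exists>x \<in> A. f x = y \<and> g x = z"
  shows "bij_betw (\<lambda>x. (f x, g x)) A (fibre_product B C h k)"
proof (rule bij_betw_imageI)
  show "inj_on (\<lambda>x. (f x, g x)) A"
    by (rule inj_onI) (simp add: assms(4))
  show "(\<lambda>x. (f x, g x)) ` A = fibre_product B C h k"
  proof (intro subset_antisym subsetI)
    fix u assume "u \<in> (\<lambda>x. (f x, g x)) ` A"
    then show "u \<in> fibre_product B C h k"
      using assms(1-3) by (auto simp: fibre_product_def)
  next
    fix u assume "u \<in> fibre_product B C h k"
    then obtain y z where "u = (y, z)" "y \<in> B" "z \<in> C" "h y = k z"
      by (auto simp: fibre_product_def)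
    with assms(5)[of y z] show "u \<in> (\<lambda>x. (f x, g x)) ` A"
      by auto
  qed
qed

lemma bij_betw_fibre_productD:
  assumes "bij_betw (\<lambda>x. (f x, g x)) A (fibre_product B C h k)"
  shows "x \<in> A \<Longrightarrow> f x \<in> B" "x \<in> A \<Longrightarrow> g x \<in> C" "x \<in> A \<Longrightarrow> h (f x) = k (g x)"
    and "x \<in> A \<Longrightarrow> x' \<in> A \<Longrightarrow> f x = f x' \<Longrightarrow> g x = g x' \<Longrightarrow> x = x'"
    and "y \<in> B \<Longrightarrow> z \<in> C \<Longrightarrow> h y = k z \<Longrightarrow> \<exists>x \<in> A. f x = y \<and> g x = z"
proof -
  note mem = bij_betwE[OF assms, rule_format, of x, unfolded fibre_product_def]
  show "x \<in> A \<Longrightarrow> f x \<in> B" "x \<in> A \<Longrightarrow> g x \<in> C" "x \<in> A \<Longrightarrow> h (f x) = k (g x)"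
    using mem by simp_all
  show "x = x'" if "x \<in> A" "x' \<in> A" "f x = f x'" "g x = g x'"
    using inj_onD[OF bij_betw_imp_inj_on[OF assms] _ that(1,2)] that(3,4) by simp
  show "\<exists>x \<in> A. f x = y \<and> g x = z" if "y \<in> B" "z \<in> C" "h y = k z"
  proof -
    have "(y, z) \<in> (\<lambda>x. (f x, g x)) ` A"
      using that by (simp add: bij_betw_imp_surj_on[OF assms] fibre_product_def)
    then show ?thesis by auto
  qed
qed

text \<open>The routes from \<open>A\<close> to \<open>D\<close> through \<open>C\<close> and
  through \<open>B\<close> agree, as do the routes below them starting at \<open>A'\<close>. So
  \<open>upper\<close> and \<open>lower\<close> paste to a pullback on the common outer rectangle,
  and cancelling \<open>right\<close> leaves a pullback on the remaining square.\<close>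

lemma pullback_paste_cancel:
  assumes right: "bij_betw (\<lambda>x. (\<beta> x, r x)) B (fibre_product B' D r' \<delta>)"
    and upper: "bij_betw (\<lambda>x. (\<alpha> x, q x)) A (fibre_product A' C q' \<gamma>)"
    and lower: "bij_betw (\<lambda>x. (\<gamma> x, s x)) C (fibre_product C' D s' \<delta>)"
    and p: "p \<in> A \<rightarrow> B" and q': "q' \<in> A' \<rightarrow> C'"
    and left: "\<And>x. x \<in> A \<Longrightarrow> p' (\<alpha> x) = \<beta> (p x)"
    and top: "\<And>x. x \<in> A \<Longrightarrow> s (q x) = r (p x)"
    and bottom: "\<And>z. z \<in> A' \<Longrightarrow> s' (q' z) = r' (p' z)"
  shows "bij_betw (\<lambda>x. (\<alpha> x, p x)) A (fibre_product A' B p' \<beta>)"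
proof (rule bij_betw_fibre_productI)
  note R = bij_betw_fibre_productD[OF right]
    and U = bij_betw_fibre_productD[OF upper]
    and L = bij_betw_fibre_productD[OF lower]
  show "\<alpha> x \<in> A'" if "x \<in> A" for x using U(1) that .
  show p_in: "p x \<in> B" if "x \<in> A" for x using p that by auto
  show "p' (\<alpha> x) = \<beta> (p x)" if "x \<in> A" for x using left that .
  show "x = x'" if x: "x \<in> A" "x' \<in> A" and "\<alpha> x = \<alpha> x'" "p x = p x'" for x x'
  \<comment> \<open>\<open>p\<close> controls \<open>q\<close> only after applying \<open>s\<close>;
    the lower square recovers \<open>q\<close> from \<open>s\<close> and \<gamma>.\<close>
  proof (rule U(4)[OF x \<open>\<alpha> x = \<alpha> x'\<close>], rule L(4))
    show "q x \<in> C" "q x' \<in> C" using U(2) x by simp_all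
    show "\<gamma> (q x) = \<gamma> (q x')" using U(3)[OF x(1)] U(3)[OF x(2)] that(3) by simp
    show "s (q x) = s (q x')" using top[OF x(1)] top[OF x(2)] that(4) by simp
  qed
  show "\<exists>x\<in>A. \<alpha> x = z \<and> p x = y" if z: "z \<in> A'" and y: "y \<in> B" and zy: "p' z = \<beta> y" for z y
  proof -
    \<comment> \<open>Both sides equal \<open>r' (p' z) = r' (\<beta> y)\<close>, so
      \<open>(q' z, r y)\<close> lifts to \<open>C\<close>.\<close>
    have "s' (q' z) = \<delta> (r y)"
      using bottom[OF z] zy R(3)[OF y] by simp
    moreover have "q' z \<in> C'" using q' z by auto
    ultimately obtain w where w: "w \<in> C" "\<gamma> w = q' z" "s w = r y"
      using L(5)[of "q' z" "r y"] R(2)[OF y] by blast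
    obtain x where x: "x \<in> A" "\<alpha> x = z" "q x = w"
      using U(5)[OF z w(1) w(2)[symmetric]] by blast
    \<comment> \<open>The lift \<open>x\<close> was built through \<open>C\<close>, so
      \<open>p x\<close> is known only under \<beta> and \<open>r\<close>, which are jointly
      injective by \<open>right\<close>.\<close>
    have "p x = y"
    proof (rule R(4)[OF p_in[OF x(1)] y])
      show "\<beta> (p x) = \<beta> y" using left[OF x(1)] x(2) zy by simp
      show "r (p x) = r y" using top[OF x(1)] x(3) w(3) by simp
    qed
    with x show ?thesis by blast
  qed
qed

lemma Gamma_set_Mor_in:
  assumes "Gamma_set X" "f \<in> PhiS_hom m n"
  shows "Mor X m n f \<in> Ob X m \<rightarrow> Ob X n"
  using assms unfolding Gamma_set_def set_functor_def PiE_def by blast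

text \<open>By functoriality, a commuting square of index maps gives one of sets, so each face
  identity below is a case check on finite maps.\<close>

lemma Gamma_set_Mor_square:
  assumes X: "Gamma_set X" and x: "x \<in> Ob X l"
    and f: "f \<in> PhiS_hom l m" and g: "g \<in> PhiS_hom m n"
    and f': "f' \<in> PhiS_hom l m'" and g': "g' \<in> PhiS_hom m' n"
    and eq: "compose {0..l} g f = compose {0..l} g' f'"
  shows "Mor X m n g (Mor X l m f x) = Mor X m' n g' (Mor X l m' f' x)"
proof -
  have "Mor X l n (compose {0..l} v u) = compose (Ob X l) (Mor X k n v) (Mor X l k u)"
    if "u \<in> PhiS_hom l k" "v \<in> PhiS_hom k n" for k u v
    using X that unfolding Gamma_set_def set_functor_def by blast
  from this[OF f g] this[OF f' g'] show ?thesis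
    using x eq by (metis compose_eq)
qed

text \<open>Merging \<open>i\<close> with \<open>i + 1\<close> becomes merging \<open>i + 1\<close>
  with \<open>i + 2\<close>, again a face. The top index is excluded: it would merge the last
  element with 1, not with the new basepoint.\<close>

lemma adjoin_base_Cut_d:
  "i < n \<Longrightarrow> adjoin_base n (Cut_d n i) = Cut_d (n + 1) (i + 1)"
  by (auto simp: adjoin_base_def Cut_d_def fun_eq_iff)

theorem theorem5p1:
  fixes X :: "'a fin_functor"
  assumes "Gamma_set X"
    and "two_Segal X"
  shows "two_Segal (hat X)"
proof -
  note X = assms(1) and S = assms(2)
  define d where "d = (\<lambda>n i. Mor X n (n - 1) (Cut_d n i))"
  \<comment> \<open>The last face of \<open>hat X\<close>. For \<open>n > 0\<close> it merges 1 and
    \<open>n + 1\<close> in $[n+1]$; the target is written as \<open>hat\<close> produces it, so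
    \<open>face_last\<close> needs no case \<open>n = 0\<close>.\<close>
  define e where "e = (\<lambda>n. Mor X (n + 1) (n - 1 + 1) (adjoin_base n (Cut_d n n)))"
  have Cut: "Cut_d (Suc n) i \<in> PhiS_hom (Suc n) n" if "i \<le> Suc n" for n i
    using Cut_d_hom[of "Suc n" i] that by simp
  have last_hom: "adjoin_base (Suc n) (Cut_d (Suc n) (Suc n)) \<in> PhiS_hom (Suc (Suc n)) (Suc n)" for n
    using adjoin_base_hom[of "Cut_d (Suc n) (Suc n)" "Suc n" n] Cut[of "Suc n" n]
    by (simp add: PhiS_hom_def)
  have Segal_first: "bij_betw (\<lambda>x. (d (n + 1) (i + 1) x, d (n + 1) 0 x)) (Ob X (n + 1))
        (fibre_product (Ob X n) (Ob X n) (d n 0) (d n i))"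
    and Segal_last: "bij_betw (\<lambda>x. (d (n + 1) i x, d (n + 1) (n + 1) x)) (Ob X (n + 1))
        (fibre_product (Ob X n) (Ob X n) (d n n) (d n i))"
    if "0 < i" "i < n" for n i
    using S that
    unfolding two_Segal_def two_Segal_sset_def underlying_sset_def d_def by simp_all
  \<comment> \<open>The two conditions for \<open>hat X\<close>, written in \<open>X\<close>:
    objects and inner faces shift by one, top faces become \<open>e\<close>.\<close>
  have first: "bij_betw (\<lambda>x. (d (n + 2) (i + 2) x, d (n + 2) 1 x)) (Ob X (n + 2))
        (fibre_product (Ob X (n + 1)) (Ob X (n + 1)) (d (n + 1) 1) (d (n + 1) (i + 1)))"
    and last: "bij_betw (\<lambda>x. (d (n + 2) (i + 1) x, e (n + 1) x)) (Ob X (n + 2))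
        (fibre_product (Ob X (n + 1)) (Ob X (n + 1)) (e n) (d (n + 1) (i + 1)))"
    if i: "0 < i" "i < n" for n i
  proof -
    obtain m where n: "n = Suc m" using i by (cases n) auto
    have d_in: "d (Suc k) j \<in> Ob X (Suc k) \<rightarrow> Ob X k" if "j \<le> Suc k" for k j
      using Gamma_set_Mor_in[OF X Cut[OF that]] by (simp add: d_def)
    have e_in: "e (Suc k) \<in> Ob X (Suc (Suc k)) \<rightarrow> Ob X (Suc k)" for k
      using Gamma_set_Mor_in[OF X last_hom] by (simp add: e_def)
    have dd: "d (Suc k) a (d (Suc (Suc k)) (Suc b) x) = d (Suc k) b (d (Suc (Suc k)) a x)"
      if "x \<in> Ob X (Suc (Suc k))" "a \<le> b" "b \<le> Suc k" for k a b x
    proof -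
      have "compose {0..Suc (Suc k)} (Cut_d (Suc k) a) (Cut_d (Suc (Suc k)) (Suc b)) =
          compose {0..Suc (Suc k)} (Cut_d (Suc k) b) (Cut_d (Suc (Suc k)) a)"
        using that by (auto simp: compose_def Cut_d_def fun_eq_iff)
      from Gamma_set_Mor_square[OF X that(1) Cut Cut Cut Cut this] show ?thesis
        using that by (simp add: d_def)
    qed
    \<comment> \<open>Both composites send 0, 1 and \<open>k + 2\<close> to the basepoint and lower
      everything else by one.\<close>
    have de: "d (Suc k) (Suc k) (d (Suc (Suc k)) 0 x) = d (Suc k) 0 (e (Suc k) x)"
      if "x \<in> Ob X (Suc (Suc k))" for k x
    proof -
      have "compose {0..Suc (Suc k)} (Cut_d (Suc k) (Suc k)) (Cut_d (Suc (Suc k)) 0) =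
          compose {0..Suc (Suc k)} (Cut_d (Suc k) 0) (adjoin_base (Suc k) (Cut_d (Suc k) (Suc k)))"
        by (auto simp: compose_def Cut_d_def adjoin_base_def fun_eq_iff)
      from Gamma_set_Mor_square[OF X that Cut Cut last_hom Cut this] show ?thesis
        by (simp add: d_def e_def)
    qed
    \<comment> \<open>The bounds keep the pair \<open>j\<close>, \<open>j + 1\<close> away from the
      basepoint and from the last element \<open>k + 3\<close>, which \<open>e\<close> moves to
      1.\<close>
    have ee: "e (Suc k) (d (Suc (Suc (Suc k))) j x) = d (Suc (Suc k)) j (e (Suc (Suc k)) x)"
      if "x \<in> Ob X (Suc (Suc (Suc k)))" "0 < j" "j \<le> Suc k" for k j x
    proof -
      have "compose {0..Suc (Suc (Suc k))} (adjoin_base (Suc k) (Cut_d (Suc k) (Suc k)))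
            (Cut_d (Suc (Suc (Suc k))) j) =
          compose {0..Suc (Suc (Suc k))} (Cut_d (Suc (Suc k)) j)
            (adjoin_base (Suc (Suc k)) (Cut_d (Suc (Suc k)) (Suc (Suc k))))"
        using that by (auto simp: compose_def Cut_d_def adjoin_base_def fun_eq_iff)
      from Gamma_set_Mor_square[OF X that(1) Cut last_hom last_hom Cut this] show ?thesis
        using that by (simp add: d_def e_def)
    qed
    have lower: "bij_betw (\<lambda>x. (d (n + 1) (i + 1) x, d (n + 1) 0 x)) (Ob X (n + 1))
        (fibre_product (Ob X n) (Ob X n) (d n 0) (d n i))"
      and lower_last: "bij_betw (\<lambda>x. (d (n + 1) i x, d (n + 1) (n + 1) x)) (Ob X (n + 1))
        (fibre_product (Ob X n) (Ob X n) (d n n) (d n i))"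
      using Segal_first Segal_last i by blast+
    \<comment> \<open>Needed below for \<open>j = i + 1\<close> and for
      \<open>j = i\<close>.\<close>
    have upper: "bij_betw (\<lambda>x. (d (n + 2) (j + 1) x, d (n + 2) 0 x)) (Ob X (n + 2))
        (fibre_product (Ob X (n + 1)) (Ob X (n + 1)) (d (n + 1) 0) (d (n + 1) j))"
      if "0 < j" "j \<le> n" for j
      using Segal_first[of j "n + 1"] that by simp
    show "bij_betw (\<lambda>x. (d (n + 2) (i + 2) x, d (n + 2) 1 x)) (Ob X (n + 2))
        (fibre_product (Ob X (n + 1)) (Ob X (n + 1)) (d (n + 1) 1) (d (n + 1) (i + 1)))"
    \<comment> \<open>The elements 0, 1, 2 are merged, starting with {0, 1} or with {1, 2}. Either
      way the pair \<open>i + 2\<close>, \<open>i + 3\<close> drops to \<open>i + 1\<close>,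
      \<open>i + 2\<close> and the second merge is \<open>d (n + 1) 0\<close>, so
      \<open>lower\<close> serves twice.\<close>
    proof (rule pullback_paste_cancel[OF lower _ lower])
      show "bij_betw (\<lambda>x. (d (n + 2) (i + 2) x, d (n + 2) 0 x)) (Ob X (n + 2))
          (fibre_product (Ob X (n + 1)) (Ob X (n + 1)) (d (n + 1) 0) (d (n + 1) (i + 1)))"
        using upper[of "i + 1"] i by simp
      show "d (n + 2) 1 \<in> Ob X (n + 2) \<rightarrow> Ob X (n + 1)" "d (n + 1) 0 \<in> Ob X (n + 1) \<rightarrow> Ob X n"
        using d_in[of 1 "n + 1"] d_in[of 0 n] by simp_all
    next
      fix x assume x: "x \<in> Ob X (n + 2)"
      show "d (n + 1) 1 (d (n + 2) (i + 2) x) = d (n + 1) (i + 1) (d (n + 2) 1 x)"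
        using dd[of x n 1 "i + 1"] x i by simp
      show "d (n + 1) 0 (d (n + 2) 0 x) = d (n + 1) 0 (d (n + 2) 1 x)"
        using dd[of x n 0 0] x by simp
    next
      fix z assume "z \<in> Ob X (n + 1)"
      then show "d n 0 (d (n + 1) 0 z) = d n 0 (d (n + 1) 1 z)"
        using dd[of z m 0 0] n by simp
    qed
    show "bij_betw (\<lambda>x. (d (n + 2) (i + 1) x, e (n + 1) x)) (Ob X (n + 2))
        (fibre_product (Ob X (n + 1)) (Ob X (n + 1)) (e n) (d (n + 1) (i + 1)))"
    \<comment> \<open>Now 0, 1 and \<open>n + 2\<close> are merged. After {0, 1} the last element
      has become \<open>n + 1\<close>, and a top face sends it to the basepoint: hence
      \<open>lower_last\<close> in the pasting.\<close>
    proof (rule pullback_paste_cancel[OF lower _ lower_last])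
      show "bij_betw (\<lambda>x. (d (n + 2) (i + 1) x, d (n + 2) 0 x)) (Ob X (n + 2))
          (fibre_product (Ob X (n + 1)) (Ob X (n + 1)) (d (n + 1) 0) (d (n + 1) i))"
        using upper[of i] i by simp
      show "e (n + 1) \<in> Ob X (n + 2) \<rightarrow> Ob X (n + 1)" "d (n + 1) 0 \<in> Ob X (n + 1) \<rightarrow> Ob X n"
        using e_in[of n] d_in[of 0 n] by simp_all
    next
      fix x assume x: "x \<in> Ob X (n + 2)"
      show "e n (d (n + 2) (i + 1) x) = d (n + 1) (i + 1) (e (n + 1) x)"
        using ee[of x m "i + 1"] x i n by simp
      show "d (n + 1) (n + 1) (d (n + 2) 0 x) = d (n + 1) 0 (e (n + 1) x)"
        using de[of x n] x by simp
    next
      fix z assume "z \<in> Ob X (n + 1)"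
      then show "d n n (d (n + 1) 0 z) = d n 0 (e n z)"
        using de[of z m] n by simp
    qed
  qed
  have face: "face (underlying_sset (hat X)) n i = d (n + 1) (i + 1)" if "i < n" for n i
    using that by (simp add: underlying_sset_def hat_def d_def adjoin_base_Cut_d[OF that, simplified])
  have face_last: "face (underlying_sset (hat X)) n n = e n" for n
    by (simp add: underlying_sset_def hat_def e_def)
  have simplices_hat: "simplices (underlying_sset (hat X)) n = Ob X (n + 1)" for n
    by (simp add: underlying_sset_def hat_def)
  show ?thesis
    unfolding two_Segal_def two_Segal_sset_def
  proof (intro allI impI conjI)
    fix n i :: nat assume i: "0 < i" "i < n"
    let ?S = "underlying_sset (hat X)"
    \<comment> \<open>All four faces lie below the top index here, so \<open>face\<close> suffices;
      the other condition has two top faces.\<close>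
    show "bij_betw (\<lambda>x. (face ?S (n + 1) (i + 1) x, face ?S (n + 1) 0 x)) (simplices ?S (n + 1))
        (fibre_product (simplices ?S n) (simplices ?S n) (face ?S n 0) (face ?S n i))"
      using first[OF i] i by (simp add: face simplices_hat)
    show "bij_betw (\<lambda>x. (face ?S (n + 1) i x, face ?S (n + 1) (n + 1) x)) (simplices ?S (n + 1))
        (fibre_product (simplices ?S n) (simplices ?S n) (face ?S n n) (face ?S n i))"
      using last[OF i] i face_last[of "Suc n"] by (simp add: face face_last simplices_hat)
  qed
qed

end
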